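(* Let $Y$ be a (compact) Cantor set and $\mu \in M^0(Y)$. Let $X \subset Y$ be an open dense subset of $Y$ of full measure (i.e. $\mu(Y\setminus X)=0$). If $\mu$ is good on $Y$, then the restriction of $\mu$ to $X$ is good on $X$.
   Context: A Cantor set is a non-empty zero-dimensional compact perfect metric space. A locally compact Cantor set is a locally compact metrizable space with no isolated points and with a countable basis of compact open sets; an open dense subset of a Cantor set is a locally compact Cantor set. For a locally compact Cantor set $Z$ (compact or non-compact), $M(Z)$ is the set of Borel measures (finite or infinite) on $Z$ that are full (every non-empty open set has positive measure) and non-atomic. For an infinite $\mu\in M(Z)$ the defective set is $\mathfrak{M}_\mu = \{x \in Z : \mu(U)=\infty \text{ for every compact open } U \ni x\}$, and $\mu$ is non-defective if $\mu(\mathfrak{M}_\mu)=0$. $M^0(Z)$ is the set of $\mu\in M(Z)$ that are either finite or infinite and non-defective. $\mu\in M^0(Z)$ is good if for all compact open $U,V\subset Z$ with $\mu(U)<\mu(V)$ there is a compact open $W\subset V$ with $\mu(W)=\mu(U)$. *)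

theory Defs
  imports "HOL-Analysis.Analysis"
begin

text \<open>
  Spaces are subsets \<open>Z\<close> of an arbitrary metric space type, with the subspace topology
  \<^term>\<open>top_of_set Z\<close>; thus they are metrizable by construction.
\<close>

definition cantor_set :: "'a::metric_space set \<Rightarrow> bool" where
  "cantor_set Y \<longleftrightarrow>
     Y \<noteq> {} \<and> compact Y \<and> top_of_set Y dim_le 0 \<and> (\<forall>x\<in>Y. x islimpt Y)"

definition compact_open_in :: "'a::metric_space set \<Rightarrow> 'a set \<Rightarrow> bool" where
  "compact_open_in Z U \<longleftrightarrow> openin (top_of_set Z) U \<and> compact U"

definition locally_compact_cantor_set :: "'a::metric_space set \<Rightarrow> bool" where
  "locally_compact_cantor_set Z \<longleftrightarrow>
     locally_compact_space (top_of_set Z) \<and> (\<forall>x\<in>Z. x islimpt Z) \<and>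
     (\<exists>\<B>. countable \<B> \<and> (\<forall>V\<in>\<B>. compact_open_in Z V) \<and>
        (\<forall>U x. openin (top_of_set Z) U \<and> x \<in> U \<longrightarrow> (\<exists>V\<in>\<B>. x \<in> V \<and> V \<subseteq> U)))"

definition borel_measure_on :: "'a::metric_space set \<Rightarrow> 'a measure \<Rightarrow> bool" where
  "borel_measure_on Z \<mu> \<longleftrightarrow> space \<mu> = Z \<and> sets \<mu> = sets (restrict_space borel Z)"

definition full_measure :: "'a::metric_space set \<Rightarrow> 'a measure \<Rightarrow> bool" where
  "full_measure Z \<mu> \<longleftrightarrow> (\<forall>U. openin (top_of_set Z) U \<and> U \<noteq> {} \<longrightarrow> emeasure \<mu> U > 0)"

text \<open>
  Absence of atoms in the measure-theoretic sense; for the measures in \<open>M\<^sup>0(Z)\<close> below,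
  which are sigma-finite, this amounts to all points being null sets.
\<close>

definition non_atomic :: "'a measure \<Rightarrow> bool" where
  "non_atomic \<mu> \<longleftrightarrow>
     (\<forall>A\<in>sets \<mu>. emeasure \<mu> A > 0 \<longrightarrow>
        (\<exists>B\<in>sets \<mu>. B \<subseteq> A \<and> 0 < emeasure \<mu> B \<and> emeasure \<mu> B < emeasure \<mu> A))"

text \<open>
  The sets \<open>M(Z)\<close> and \<open>M\<^sup>0(Z)\<close>, for a locally compact Cantor set \<open>Z\<close>; see
  \<open>open_subset_cantor_set\<close> below for the spaces at hand. A measure may take the
  value \<open>\<infinity>\<close>, and neither finiteness nor sigma-finiteness is built in.
\<close>

definition measures_M :: "'a::metric_space set \<Rightarrow> 'a measure set" where
  "measures_M Z = {\<mu>. borel_measure_on Z \<mu> \<and> full_measure Z \<mu> \<and> non_atomic \<mu>}"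

definition defective_set :: "'a::metric_space set \<Rightarrow> 'a measure \<Rightarrow> 'a set" where
  "defective_set Z \<mu> = {x\<in>Z. \<forall>U. compact_open_in Z U \<and> x \<in> U \<longrightarrow> emeasure \<mu> U = \<infinity>}"

definition measures_M0 :: "'a::metric_space set \<Rightarrow> 'a measure set" where
  "measures_M0 Z =
     {\<mu> \<in> measures_M Z. emeasure \<mu> Z < \<infinity> \<or>
        (emeasure \<mu> Z = \<infinity> \<and> emeasure \<mu> (defective_set Z \<mu>) = 0)}"

text \<open>Goodness is a property of elements of \<open>M\<^sup>0(Z)\<close> only, so membership is part of it.\<close>

definition good_measure :: "'a::metric_space set \<Rightarrow> 'a measure \<Rightarrow> bool" where
  "good_measure Z \<mu> \<longleftrightarrow> \<mu> \<in> measures_M0 Z \<and>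
     (\<forall>U V. compact_open_in Z U \<and> compact_open_in Z V \<and> emeasure \<mu> U < emeasure \<mu> V \<longrightarrow>
        (\<exists>W. compact_open_in Z W \<and> W \<subseteq> V \<and> emeasure \<mu> W = emeasure \<mu> U))"

text \<open>
  \<^const>\<open>emeasure\<close> is \<open>0\<close> outside the sigma-algebra; the defective set is relatively closed,
  so this convention does not affect \<^const>\<open>measures_M0\<close>.
\<close>

lemma defective_set_measurable:
  assumes "borel_measure_on Z \<mu>"
  shows "defective_set Z \<mu> \<in> sets \<mu>"
proof -
  let ?C = "\<Union>{U. compact_open_in Z U \<and> emeasure \<mu> U \<noteq> \<infinity>}"
  have "openin (top_of_set Z) ?C"
    by (rule openin_Union) (auto simp: compact_open_in_def)
  then obtain T where T: "open T" "?C = Z \<inter> T"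
    by (auto simp: openin_open)
  have "defective_set Z \<mu> = Z - ?C"
    by (auto simp: defective_set_def)
  also have "\<dots> = Z \<inter> (- T)"
    using T(2) by blast
  finally show ?thesis
    using assms T(1) by (auto simp: borel_measure_on_def sets_restrict_space)
qed

lemma open_subset_cantor_set:
  assumes Y: "cantor_set Y" and X: "openin (top_of_set Y) X"
  shows "locally_compact_cantor_set X"
proof -
  have cY: "compact Y" and dY: "top_of_set Y dim_le 0" and lY: "\<forall>x\<in>Y. x islimpt Y"
    using Y by (auto simp: cantor_set_def)
  have XY: "X \<subseteq> Y"
    using X openin_imp_subset by blast
  obtain O' where O': "open O'" "X = Y \<inter> O'"
    using X by (auto simp: openin_open)
  have clopen_base: "\<exists>V. openin (top_of_set X) V \<and> compact V \<and> x \<in> V \<and> V \<subseteq> U"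
    if U: "openin (top_of_set X) U" and x: "x \<in> U" for U x
  proof -
    have UY: "openin (top_of_set Y) U"
      using U X openin_trans by blast
    obtain V where V: "closedin (top_of_set Y) V" "openin (top_of_set Y) V" "x \<in> V" "V \<subseteq> U"
      using dY UY x unfolding dimension_le_0_neighbourhood_base_of_clopen
      by (subst (asm) open_neighbourhood_base_of) (auto, blast)
    have "compact V"
      using V(1) cY closedin_compact by blast
    moreover have "openin (top_of_set X) V"
      using V U openin_subset_trans[OF V(2) _ XY] openin_imp_subset by blast
    ultimately show ?thesis
      using V by blast
  qed
  have lim: "x islimpt X" if "x \<in> X" for x
    using that lY O' XY by (auto simp: islimpt_def) (metis IntE IntI open_Int)
  have lc: "locally_compact_space (top_of_set X)"
    unfolding locally_compact_space_def
    using clopen_base[OF openin_subtopology_self]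
    by (auto simp: compactin_subtopology) (metis order_refl)
  have "second_countable (top_of_set Y)"
  proof -
    have "\<forall>n. \<exists>K. finite K \<and> Y \<subseteq> (\<Union>x\<in>K. ball x (inverse (real (Suc n))))"
      using cY unfolding compact_eq_totally_bounded by simp
    then obtain K where K: "\<And>n. finite (K n)"
      "\<And>n. Y \<subseteq> (\<Union>x\<in>K n. ball x (inverse (real (Suc n))))"
      by metis
    define \<A> where "\<A> = (\<Union>n. (\<lambda>x. Y \<inter> ball x (inverse (real (Suc n)))) ` K n)"
    have "countable \<A>"
      unfolding \<A>_def using K(1) by (intro countable_UN) (auto intro: countable_finite)
    moreover have "\<forall>V\<in>\<A>. openin (top_of_set Y) V"
      unfolding \<A>_def by auto
    moreover have "\<exists>V\<in>\<A>. x \<in> V \<and> V \<subseteq> U"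
      if U: "openin (top_of_set Y) U" and x: "x \<in> U" for U x
    proof -
      obtain e where e: "e > 0" "\<And>y. y \<in> Y \<Longrightarrow> dist y x < e \<Longrightarrow> y \<in> U" and "x \<in> Y"
        using U x by (meson openin_euclidean_subtopology_iff subsetD)
      obtain n where n: "inverse (real (Suc n)) < e / 2"
        using reals_Archimedean[of "e / 2"] e(1) by auto
      obtain z where z: "z \<in> K n" "dist z x < inverse (real (Suc n))"
        using K(2)[of n] \<open>x \<in> Y\<close> by auto
      have "Y \<inter> ball z (inverse (real (Suc n))) \<subseteq> U"
      proof
        fix y assume y: "y \<in> Y \<inter> ball z (inverse (real (Suc n)))"
        then have "dist y x < e"
          using dist_triangle[of y x z] z(2) n by (simp add: dist_commute)
        then show "y \<in> U"
          using e(2) y by blast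
      qed
      moreover have "Y \<inter> ball z (inverse (real (Suc n))) \<in> \<A>"
        using z(1) unfolding \<A>_def by (intro UN_I[of n] imageI) auto
      ultimately show ?thesis
        using z(2) \<open>x \<in> Y\<close> by (metis IntI mem_ball)
    qed
    ultimately show ?thesis
      unfolding second_countable_def by blast
  qed
  then have "second_countable (top_of_set X)"
    using second_countable_subtopology[of "top_of_set Y" X] XY
    by (simp add: subtopology_subtopology Int_absorb1)
  then obtain \<A> where \<A>: "countable \<A>" "\<And>V. V \<in> \<A> \<Longrightarrow> openin (top_of_set X) V"
    "\<And>U x. openin (top_of_set X) U \<Longrightarrow> x \<in> U \<Longrightarrow> \<exists>V\<in>\<A>. x \<in> V \<and> V \<subseteq> U"
    unfolding second_countable_def by metis
  define \<B> where "\<B> = {V. compact_open_in X V}"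
  have "V \<in> Union ` {\<F>. finite \<F> \<and> \<F> \<subseteq> \<A>}" if "V \<in> \<B>" for V
  proof -
    have V: "openin (top_of_set X) V" "compact V"
      using that by (auto simp: \<B>_def compact_open_in_def)
    define \<C> where "\<C> = {A\<in>\<A>. A \<subseteq> V}"
    have "V = \<Union>\<C>"
    proof
      show "V \<subseteq> \<Union>\<C>"
      proof
        fix x assume "x \<in> V"
        then obtain A where "A \<in> \<A>" "x \<in> A" "A \<subseteq> V"
          using \<A>(3)[OF V(1)] by meson
        then show "x \<in> \<Union>\<C>"
          by (auto simp: \<C>_def)
      qed
    qed (auto simp: \<C>_def)
    moreover have "\<forall>C\<in>\<C>. openin (top_of_set V) C"
    proof
      fix C assume "C \<in> \<C>"
      then show "openin (top_of_set V) C"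
        using openin_subset_trans[OF \<A>(2) _ openin_imp_subset[OF V(1)]]
        by (simp add: \<C>_def)
    qed
    ultimately obtain \<D> where \<D>: "\<D> \<subseteq> \<C>" "finite \<D>" "V \<subseteq> \<Union>\<D>"
      using V(2)[unfolded compact_eq_openin_cover, rule_format, of \<C>] by auto
    show ?thesis
    proof (rule image_eqI)
      show "V = \<Union>\<D>" "\<D> \<in> {\<F>. finite \<F> \<and> \<F> \<subseteq> \<A>}"
        using \<D> by (auto simp: \<C>_def)
    qed
  qed
  then have "countable \<B>"
    by (intro countable_subset[OF subsetI countable_image[OF countable_Collect_finite_subset[OF \<A>(1)]]])
  moreover have "\<forall>U x. openin (top_of_set X) U \<and> x \<in> U \<longrightarrow> (\<exists>V\<in>\<B>. x \<in> V \<and> V \<subseteq> U)"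
    using clopen_base unfolding \<B>_def compact_open_in_def by (simp add: Bex_def)
  ultimately show ?thesis
    unfolding locally_compact_cantor_set_def using lc lim
    by (intro conjI exI[of _ \<B>]) (auto simp: \<B>_def)
qed

end

theory Submission
  imports Defs
begin

text \<open>
  A compact open subset of the open set \<open>X\<close> is compact open in \<open>Y\<close>, and a compact open
  subset of \<open>Y\<close> contained in \<open>X\<close> is compact open in \<open>X\<close>. Hence the set \<open>W \<subseteq> V\<close> given by
  goodness on \<open>Y\<close> already serves on \<open>X\<close>. Since compact open sets form a base of \<open>X\<close>,
  a point of \<open>X\<close> that is defective for the restriction is defective for \<open>\<mu>\<close>.
\<close>

text \<open>\<open>compact U\<close> does not refer to the ambient space, so only relative openness
  has to be transferred: upwards by transitivity, as \<open>X\<close> is open in \<open>Y\<close>,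
  and downwards because \<open>U \<subseteq> X \<subseteq> Y\<close>.\<close>

lemma compact_open_in_open_subset:
  assumes "openin (top_of_set Y) X"
  shows "compact_open_in X U \<longleftrightarrow> compact_open_in Y U \<and> U \<subseteq> X"
  unfolding compact_open_in_def
  by (meson assms openin_imp_subset openin_subset_trans openin_trans)

lemma open_in_sets_borel_measure_on:
  assumes "borel_measure_on Y \<mu>" "openin (top_of_set Y) X"
  shows "X \<in> sets \<mu>"
proof -
  obtain T where "open T" "X = Y \<inter> T"
    using assms(2) by (auto simp: openin_open)
  then have "X \<in> sets (restrict_space borel Y)"
    by (auto simp: sets_restrict_space)
  then show ?thesis
    using assms(1) by (simp add: borel_measure_on_def)
qed

lemma borel_measure_on_restrict_space:
  assumes "borel_measure_on Y \<mu>" "X \<subseteq> Y"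
  shows "borel_measure_on X (restrict_space \<mu> X)"
proof -
  \<comment> \<open>The trace sigma-algebra depends on \<open>\<mu>\<close> only through
    \<open>sets \<mu>\<close>; the iterated trace then collapses to the trace on
    \<open>Y \<inter> X = X\<close>.\<close>
  have "sets (restrict_space \<mu> X) = sets (restrict_space (restrict_space borel Y) X)"
    using assms(1) by (intro sets_restrict_space_cong) (simp add: borel_measure_on_def)
  then show ?thesis
    using assms
    by (simp add: borel_measure_on_def space_restrict_space sets_restrict_restrict_space
        Int_absorb1 Int_absorb2)
qed

lemma full_measure_restrict_space:
  assumes "full_measure Y \<mu>" "openin (top_of_set Y) X" "X \<in> sets \<mu>"
  shows "full_measure X (restrict_space \<mu> X)"
  unfolding full_measure_def
proof (intro allI impI)
  fix U assume U: "openin (top_of_set X) U \<and> U \<noteq> {}"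
  then have "0 < emeasure \<mu> U"
    using assms(1,2) openin_trans unfolding full_measure_def by blast
  moreover have "emeasure (restrict_space \<mu> X) U = emeasure \<mu> U"
    using U assms(3) by (intro emeasure_restrict_space) (auto dest: openin_imp_subset)
  ultimately show "0 < emeasure (restrict_space \<mu> X) U"
    by simp
qed

text \<open>A set that splits \<open>A\<close> with respect to \<open>\<mu>\<close> lies in
  \<open>A \<subseteq> X\<close>, where both measures have the same measurable sets and
  values.\<close>

lemma non_atomic_restrict_space:
  assumes "non_atomic \<mu>" "X \<in> sets \<mu>"
  shows "non_atomic (restrict_space \<mu> X)"
  unfolding non_atomic_def
proof (intro ballI impI)
  have X: "X \<inter> space \<mu> \<in> sets \<mu>"
    using assms(2) by simp
  fix A assume "A \<in> sets (restrict_space \<mu> X)" "0 < emeasure (restrict_space \<mu> X) A"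
  then have A: "A \<in> sets \<mu>" "A \<subseteq> X" "0 < emeasure \<mu> A"
    using X by (auto simp: sets_restrict_space_iff emeasure_restrict_space)
  then obtain B where "B \<in> sets \<mu>" "B \<subseteq> A" "0 < emeasure \<mu> B" "emeasure \<mu> B < emeasure \<mu> A"
    using assms(1) by (meson non_atomic_def)
  then show "\<exists>B\<in>sets (restrict_space \<mu> X). B \<subseteq> A \<and> 0 < emeasure (restrict_space \<mu> X) B \<and>
      emeasure (restrict_space \<mu> X) B < emeasure (restrict_space \<mu> X) A"
    using A X by (intro bexI[of _ B]) (auto simp: sets_restrict_space_iff emeasure_restrict_space)
qed

lemma defective_set_restrict_space_subset:
  assumes Y: "cantor_set Y" and X: "openin (top_of_set Y) X" and \<mu>: "borel_measure_on Y \<mu>"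
  shows "defective_set X (restrict_space \<mu> X) \<subseteq> defective_set Y \<mu>"
proof
  fix x assume x: "x \<in> defective_set X (restrict_space \<mu> X)"
  then have xX: "x \<in> X"
    by (simp add: defective_set_def)
  have X_sets: "X \<inter> space \<mu> \<in> sets \<mu>"
    using open_in_sets_borel_measure_on[OF \<mu> X] by simp
  have "emeasure \<mu> U = \<infinity>" if U: "compact_open_in Y U" "x \<in> U" for U
  proof -
    \<comment> \<open>\<open>U\<close> may leave \<open>X\<close>, and \<open>X \<inter> U\<close>
      may fail to be compact; hence the passage to a basic compact open \<open>V\<close> around
      \<open>x\<close>, whose infinite measure forces that of \<open>U\<close>.\<close>
    have "openin (top_of_set X) (X \<inter> U)"
      using U(1) X openin_imp_subset[OF X]
      by (metis compact_open_in_def inf_le1 openin_Int openin_subset_trans)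
    then obtain V where V: "compact_open_in X V" "x \<in> V" "V \<subseteq> X \<inter> U"
      using open_subset_cantor_set[OF Y X] xX U(2) unfolding locally_compact_cantor_set_def
      by (metis IntI)
    have "\<infinity> = emeasure (restrict_space \<mu> X) V"
      using x V by (simp add: defective_set_def)
    also have "\<dots> = emeasure \<mu> V"
      using V(3) X_sets by (intro emeasure_restrict_space) auto
    also have "\<dots> \<le> emeasure \<mu> U"
      using V(3) U(1) open_in_sets_borel_measure_on[OF \<mu>]
      by (intro emeasure_mono) (auto simp: compact_open_in_def)
    finally show ?thesis
      by (simp add: top.extremum_unique)
  qed
  then show "x \<in> defective_set Y \<mu>"
    using xX openin_imp_subset[OF X] by (auto simp: defective_set_def)
qed

lemma measures_M0_restrict_space:
  assumes Y: "cantor_set Y" and X: "openin (top_of_set Y) X" and "\<mu> \<in> measures_M0 Y"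
  shows "restrict_space \<mu> X \<in> measures_M0 X"
proof -
  let ?\<nu> = "restrict_space \<mu> X"
  have \<mu>: "borel_measure_on Y \<mu>" "full_measure Y \<mu>" "non_atomic \<mu>"
    and fin: "emeasure \<mu> Y < \<infinity> \<or> emeasure \<mu> (defective_set Y \<mu>) = 0"
    using assms(3) by (auto simp: measures_M0_def measures_M_def)
  have XY: "X \<subseteq> Y"
    using X openin_imp_subset by blast
  have X_sets: "X \<in> sets \<mu>"
    using open_in_sets_borel_measure_on[OF \<mu>(1) X] .
  \<comment> \<open>This covers every subset of the measurable set \<open>X\<close>: a
    non-measurable \<open>A\<close> is so for both measures, and both values are the default
    0.\<close>
  have eq: "emeasure ?\<nu> A = emeasure \<mu> A" if "A \<subseteq> X" for A
    using that X_sets by (intro emeasure_restrict_space) auto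
  have "?\<nu> \<in> measures_M X"
    using borel_measure_on_restrict_space[OF \<mu>(1) XY] full_measure_restrict_space[OF \<mu>(2) X X_sets]
      non_atomic_restrict_space[OF \<mu>(3) X_sets]
    by (simp add: measures_M_def)
  moreover have "emeasure ?\<nu> X < \<infinity>" if "emeasure \<mu> Y < \<infinity>"
    using emeasure_mono[OF XY open_in_sets_borel_measure_on[OF \<mu>(1) openin_subtopology_self]] that
    by (simp add: eq le_less_trans)
  moreover have "emeasure ?\<nu> (defective_set X ?\<nu>) = 0" if "emeasure \<mu> (defective_set Y \<mu>) = 0"
  proof -
    \<comment> \<open>Monotonicity requires the larger set to be measurable, which
      \<open>defective_set_measurable\<close> provides; its value 0 is thus not a mere
      default.\<close>
    have "emeasure \<mu> (defective_set X ?\<nu>) \<le> emeasure \<mu> (defective_set Y \<mu>)"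
      by (intro emeasure_mono defective_set_restrict_space_subset defective_set_measurable Y X \<mu>)
    then show ?thesis
      using that by (subst eq) (auto simp: defective_set_def)
  qed
  ultimately show ?thesis
    \<comment> \<open>A null defective set suffices in both cases: if
      \<open>emeasure ?\<nu> X\<close> is finite, the first alternative of
      \<open>measures_M0\<close> holds, otherwise the second.\<close>
    using fin by (auto simp: measures_M0_def less_top[symmetric])
qed

theorem corollary3p10:
  fixes X Y :: "'a::metric_space set" and \<mu> :: "'a measure"
  assumes "cantor_set Y"
    and "\<mu> \<in> measures_M0 Y"
    and "openin (top_of_set Y) X"
    and "(top_of_set Y) closure_of X = Y"
    and "emeasure \<mu> (Y - X) = 0"
    and "good_measure Y \<mu>"
  shows "good_measure X (restrict_space \<mu> X)"
  unfolding good_measure_def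
proof (intro conjI allI impI)
  show "restrict_space \<mu> X \<in> measures_M0 X"
    by (rule measures_M0_restrict_space[OF assms(1,3,2)])
next
  fix U V
  assume UV: "compact_open_in X U \<and> compact_open_in X V \<and>
    emeasure (restrict_space \<mu> X) U < emeasure (restrict_space \<mu> X) V"
  note co = compact_open_in_open_subset[OF assms(3)]
  have "X \<in> sets \<mu>"
    using assms(2,3) open_in_sets_borel_measure_on by (auto simp: measures_M0_def measures_M_def)
  then have eq: "emeasure (restrict_space \<mu> X) A = emeasure \<mu> A" if "A \<subseteq> X" for A
    using that by (intro emeasure_restrict_space) auto
  have "U \<subseteq> X" "V \<subseteq> X" "compact_open_in Y U" "compact_open_in Y V"
    using UV co by auto
  \<comment> \<open>\<open>eq\<close> turns the strict inequality into one for \<open>\<mu>\<close>;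
    it also carries the equality back, since \<open>W \<subseteq> V \<subseteq> X\<close>.\<close>
  then obtain W where W: "compact_open_in Y W" "W \<subseteq> V" "emeasure \<mu> W = emeasure \<mu> U"
    using assms(6) UV unfolding good_measure_def by (metis eq)
  with \<open>U \<subseteq> X\<close> \<open>V \<subseteq> X\<close>
  show "\<exists>W. compact_open_in X W \<and> W \<subseteq> V \<and>
      emeasure (restrict_space \<mu> X) W = emeasure (restrict_space \<mu> X) U"
    by (intro exI[of _ W]) (auto simp: co eq)
qed

end
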